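(* Let $c\in[0,1)$ and let $f:\mathbb{R}\to\mathbb{R}$ be continuous. Assume that $f$ is continuously differentiable at zero and that $$0<\frac{f(t)}{t}\le f'(0)<1\quad\text{for all } t\ne 0 .$$ Then the difference equation $$x_{n+1}=cx_n+f(x_n-x_{n-1}),\qquad n=1,2,\ldots,$$ is oscillatory if and only if $f'(0)>(1-\sqrt{1-c})^{2}$.
   Context: A solution of the difference equation is a real sequence $\{x_n\}_{n\ge 0}$ satisfying it for all $n\ge 1$, with arbitrary real initial values $x_0,x_1$. The equation is called oscillatory if each of its solutions is neither eventually negative nor eventually positive, where a sequence is eventually positive (resp. negative) if $x_n>0$ (resp. $x_n<0$) for all sufficiently large $n$. "Continuously differentiable at zero" means that $f$ is differentiable in a neighborhood of $0$ and $f'$ is continuous at $0$. *)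

theory Defs
  imports "HOL-Analysis.Analysis"
begin

definition continuously_differentiable_at :: "(real \<Rightarrow> real) \<Rightarrow> real \<Rightarrow> bool" where
  "continuously_differentiable_at f a \<longleftrightarrow>
     (\<forall>\<^sub>F t in nhds a. f differentiable (at t)) \<and> isCont (deriv f) a"

definition eventually_positive :: "(nat \<Rightarrow> real) \<Rightarrow> bool" where
  "eventually_positive x \<longleftrightarrow> (\<forall>\<^sub>F n in sequentially. x n > 0)"

definition eventually_negative :: "(nat \<Rightarrow> real) \<Rightarrow> bool" where
  "eventually_negative x \<longleftrightarrow> (\<forall>\<^sub>F n in sequentially. x n < 0)"

(* x 0 and x 1 are unconstrained; the recurrence starts at n = 1. *)
definition solves_difference_eq :: "real \<Rightarrow> (real \<Rightarrow> real) \<Rightarrow> (nat \<Rightarrow> real) \<Rightarrow> bool" where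
  "solves_difference_eq c f x \<longleftrightarrow>
     (\<forall>n\<ge>1. x (n + 1) = c * x n + f (x n - x (n - 1)))"

definition oscillatory_difference_eq :: "real \<Rightarrow> (real \<Rightarrow> real) \<Rightarrow> bool" where
  "oscillatory_difference_eq c f \<longleftrightarrow>
     (\<forall>x. solves_difference_eq c f x \<longrightarrow>
        \<not> eventually_negative x \<and> \<not> eventually_positive x)"

end

theory Submission
  imports Defs
begin

text \<open>
  Write $a = f'(0)$. The linearisation $x_{n+1} = c x_n + a (x_n - x_{n-1})$ has the
  characteristic polynomial $\lambda^2 - (c + a) \lambda + a$, and the inequality
  $a > (1 - \sqrt{1 - c})^2$ says exactly that it has no real root, i.e. that $c + a < 2 \sqrt a$
  (\<open>threshold_iff_negative_discriminant\<close>).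

  Suppose that this inequality holds and that $x$ is a positive solution. The increments cannot
  stay positive, because $f(d) \le d$ for $d > 0$ and every step costs a further $(1 - c) x_n$;
  and an increment that is $\le 0$ is followed only by negative ones. So $x$ decreases, its
  limit $L$ satisfies $L = c L$, hence $x_n \to 0$, and the slopes $q_n = f(d_n)/d_n$ along the
  increments tend to $a$. The ratios $r_n = x_{n+1}/x_n > 0$ obey
  $r_{n+1} = c + q_n - q_n / r_n \le r_n - (2 \sqrt{q_n} - c - q_n)$,
  and the bracket is eventually bounded below by a positive constant, so the ratios become
  negative: a contradiction (\<open>no_positive_solution\<close>). Passing to $-x$ and
  $t \mapsto -f(-t)$ excludes negative solutions.

  Conversely, if $2 s \le c + s^2$ for $s = \sqrt a$, then the solution with
  $x_0 = x_1 = 1$ stays positive: since $f(d) \ge s^2 d$ for $d \le 0$, the bounds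
  $s x_{n-1} \le x_n \le x_{n-1}$ propagate (\<open>solution_bounded_below_by_ratio\<close>).
\<close>

section \<open>Discriminant and slope bounds\<close>

lemma threshold_iff_negative_discriminant:
  fixes a c :: real
  assumes "0 \<le> c" "c < 1" "0 < a" "a < 1"
  shows "a > (1 - sqrt (1 - c))\<^sup>2 \<longleftrightarrow> c + a < 2 * sqrt a"
proof -
  have "a > (1 - sqrt (1 - c))\<^sup>2 \<longleftrightarrow> sqrt a > 1 - sqrt (1 - c)"
    using assms by (metis abs_of_nonneg diff_ge_0_iff_ge diff_le_eq le_add_same_cancel1
        real_sqrt_abs real_sqrt_le_1_iff real_sqrt_less_iff)
  also have "\<dots> \<longleftrightarrow> 1 - sqrt a < sqrt (1 - c)"
    by linarith
  also have "\<dots> \<longleftrightarrow> (1 - sqrt a)\<^sup>2 < 1 - c"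
    using assms by (metis abs_of_nonneg diff_ge_0_iff_ge less_eq_real_def real_sqrt_abs
        real_sqrt_le_1_iff real_sqrt_less_iff)
  also have "\<dots> \<longleftrightarrow> c + a < 2 * sqrt a"
    using assms by (auto simp: power2_diff)
  finally show ?thesis .
qed

lemma constant_descent_becomes_negative:
  fixes u :: "nat \<Rightarrow> real"
  assumes "e > 0" and step: "\<And>n. n \<ge> N \<Longrightarrow> u (Suc n) \<le> u n - e"
  shows "\<exists>n\<ge>N. u n < 0"
proof -
  have bound: "u (N + k) \<le> u N - of_nat k * e" for k
  proof (induction k)
    case (Suc k)
    with step[of "N + k"] show ?case by (simp add: algebra_simps)
  qed simp
  obtain k where "u N < of_nat k * e"
    using reals_Archimedean3[OF \<open>e > 0\<close>] by blast
  with bound[of k] show ?thesis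
    by (intro exI[of _ "N + k"]) auto
qed

lemma slope_bounds:
  fixes f :: "real \<Rightarrow> real"
  assumes "\<And>t. t \<noteq> 0 \<Longrightarrow> 0 < f t / t \<and> f t / t \<le> a"
  shows "t > 0 \<Longrightarrow> 0 < f t \<and> f t \<le> a * t"
    and "t < 0 \<Longrightarrow> f t < 0 \<and> a * t \<le> f t"
  using assms[of t] by (auto simp: divide_simps split: if_splits)

lemma slope_bounds_imp_zero_at_0:
  fixes f :: "real \<Rightarrow> real"
  assumes slope: "\<And>t. t \<noteq> 0 \<Longrightarrow> 0 < f t / t \<and> f t / t \<le> a"
    and "isCont f 0"
  shows "f 0 = 0"
proof -
  have "f \<midarrow>0\<rightarrow> f 0"
    using \<open>isCont f 0\<close> by (simp add: isCont_def)
  hence right: "(f \<longlongrightarrow> f 0) (at_right 0)" and left: "(f \<longlongrightarrow> f 0) (at_left 0)"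
    by (auto simp: filterlim_at_split)
  have "f 0 \<ge> 0"
    by (rule tendsto_lowerbound[OF right])
       (use slope_bounds(1)[of f, OF slope] in
          \<open>auto simp: eventually_at_filter intro!: always_eventually less_imp_le\<close>)
  moreover have "f 0 \<le> 0"
    by (rule tendsto_upperbound[OF left])
       (use slope_bounds(2)[of f, OF slope] in
          \<open>auto simp: eventually_at_filter intro!: always_eventually less_imp_le\<close>)
  ultimately show ?thesis by simp
qed

section \<open>Nonexistence of positive solutions\<close>

text \<open>
  As long as the solution grows, every increment is smaller than the previous one by at least the
  fixed amount $(1 - c) y_0$. After the first increment that is not positive, $f$ of the
  increment only helps the decay.
\<close>

lemma positive_solution_eventually_decreasing:
  fixes f :: "real \<Rightarrow> real" and y :: "nat \<Rightarrow> real"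
  assumes "c < 1" "a < 1"
    and slope: "\<And>t. t \<noteq> 0 \<Longrightarrow> 0 < f t / t \<and> f t / t \<le> a"
    and "f 0 = 0"
    and rec: "\<And>n. y (Suc (Suc n)) = c * y (Suc n) + f (y (Suc n) - y n)"
    and pos: "\<And>n. y n > 0"
  obtains M where "\<And>n. n \<ge> M \<Longrightarrow> y (Suc n) < y n"
proof -
  define d where "d n = y (Suc n) - y n" for n
  have d_step: "d (Suc n) = f (d n) - (1 - c) * y (Suc n)" for n
    by (simp add: d_def rec algebra_simps)
  have loss: "(1 - c) * y n > 0" for n
    using pos \<open>c < 1\<close> by simp
  have "\<exists>M. d M \<le> 0"
  proof (rule ccontr)
    assume "\<not> ?thesis"
    hence d_pos: "d n > 0" for n by (meson not_le)
    have "incseq y"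
      using d_pos by (auto simp: d_def intro!: incseq_SucI less_imp_le)
    have "d (Suc n) \<le> d n - (1 - c) * y 0" for n
    proof -
      have "f (d n) \<le> a * d n"
        using slope_bounds(1)[of f, OF slope d_pos] by blast
      also have "\<dots> \<le> d n"
        using d_pos[of n] \<open>a < 1\<close> by simp
      finally have "f (d n) \<le> d n" .
      moreover have "(1 - c) * y 0 \<le> (1 - c) * y (Suc n)"
        using \<open>incseq y\<close> \<open>c < 1\<close> by (intro mult_left_mono) (auto simp: incseq_def)
      ultimately show ?thesis by (simp add: d_step)
    qed
    with constant_descent_becomes_negative[OF loss[of 0], of 0 d] d_pos show False
      by (metis less_asym)
  qed
  then obtain M where "d M \<le> 0" by blast
  have d_Suc_neg: "d (Suc n) < 0" if "d n \<le> 0" for n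
    using that slope_bounds(2)[of f, OF slope, of "d n"] loss[of "Suc n"] \<open>f 0 = 0\<close>
    by (cases "d n = 0") (auto simp: d_step)
  have "d n < 0" if "n \<ge> Suc M" for n
    using that
  proof (induction n rule: dec_induct)
    case base
    show ?case using d_Suc_neg[OF \<open>d M \<le> 0\<close>] .
  next
    case (step n)
    thus ?case using d_Suc_neg[of n] by simp
  qed
  thus ?thesis
    by (intro that[of "Suc M"]) (simp add: d_def)
qed

lemma decreasing_positive_solution_tendsto_zero:
  fixes f :: "real \<Rightarrow> real" and y :: "nat \<Rightarrow> real"
  assumes "c < 1" "f 0 = 0" "isCont f 0"
    and rec: "\<And>n. y (Suc (Suc n)) = c * y (Suc n) + f (y (Suc n) - y n)"
    and pos: "\<And>n. y n > 0"
    and dec: "\<And>n. n \<ge> M \<Longrightarrow> y (Suc n) < y n"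
  shows "y \<longlonglongrightarrow> 0"
proof -
  have "decseq (\<lambda>n. y (n + M))"
    using dec by (intro decseq_SucI) (simp add: less_imp_le)
  then obtain L where "(\<lambda>n. y (n + M)) \<longlonglongrightarrow> L"
    using decseq_convergent[of "\<lambda>n. y (n + M)" 0] pos less_imp_le by metis
  hence L: "y \<longlonglongrightarrow> L" by (simp add: LIMSEQ_offset)
  hence L1: "(\<lambda>n. y (Suc n)) \<longlonglongrightarrow> L" and L2: "(\<lambda>n. y (Suc (Suc n))) \<longlonglongrightarrow> L"
    by (auto simp: filterlim_sequentially_Suc intro: LIMSEQ_Suc)
  have "(\<lambda>n. y (Suc n) - y n) \<longlonglongrightarrow> 0"
    using tendsto_diff[OF L1 L] by simp
  hence "(\<lambda>n. f (y (Suc n) - y n)) \<longlonglongrightarrow> f 0"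
    using \<open>isCont f 0\<close> isCont_tendsto_compose by blast
  hence "(\<lambda>n. y (Suc (Suc n))) \<longlonglongrightarrow> c * L + 0"
    unfolding rec using \<open>f 0 = 0\<close> by (intro tendsto_intros L1) simp
  with L2 have "L = c * L + 0" by (rule LIMSEQ_unique)
  with \<open>c < 1\<close> have "L = 0" by simp
  with L show ?thesis by simp
qed

text \<open>
  The map $r \mapsto c + q - q/r$ moves every $r > 0$ down by at least
  $2 \sqrt q - c - q$, because $r + q/r \ge 2 \sqrt q$ by the inequality of arithmetic and
  geometric means.
\<close>

lemma ratio_map_descent:
  fixes q r c :: real
  assumes "q \<ge> 0" "r > 0"
  shows "c + q * (1 - 1 / r) \<le> r - (2 * sqrt q - c - q)"
proof -
  have "0 \<le> (r - sqrt q)\<^sup>2 / r"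
    using \<open>r > 0\<close> by simp
  also have "(r - sqrt q)\<^sup>2 / r = r + q / r - 2 * sqrt q"
    using assms by (simp add: power2_diff field_simps power2_eq_square)
  finally show ?thesis by (simp add: algebra_simps)
qed

lemma no_positive_solution:
  fixes f :: "real \<Rightarrow> real" and y :: "nat \<Rightarrow> real"
  assumes "c < 1" "a < 1"
    and slope: "\<And>t. t \<noteq> 0 \<Longrightarrow> 0 < f t / t \<and> f t / t \<le> a"
    and deriv: "(f has_real_derivative a) (at 0)"
    and disc: "c + a < 2 * sqrt a"
    and rec: "\<And>n. y (Suc (Suc n)) = c * y (Suc n) + f (y (Suc n) - y n)"
    and pos: "\<And>n. y n > 0"
  shows False
proof -
  have "isCont f 0"
    using deriv DERIV_isCont by blast
  have "f 0 = 0"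
    using slope_bounds_imp_zero_at_0[OF slope \<open>isCont f 0\<close>] .
  obtain M where dec: "\<And>n. n \<ge> M \<Longrightarrow> y (Suc n) < y n"
    using positive_solution_eventually_decreasing
      [where f = f and y = y, OF \<open>c < 1\<close> \<open>a < 1\<close> slope \<open>f 0 = 0\<close> rec pos]
    by blast
  have y_lim: "y \<longlonglongrightarrow> 0"
    using decreasing_positive_solution_tendsto_zero
      [where f = f and y = y, OF \<open>c < 1\<close> \<open>f 0 = 0\<close> \<open>isCont f 0\<close> rec pos dec] .
  define d where "d n = y (Suc n) - y n" for n
  define q where "q n = f (d n) / d n" for n
  define r where "r n = y (Suc n) / y n" for n
  have d_neg: "d n < 0" if "n \<ge> M" for n
    using dec[OF that] by (simp add: d_def)
  have "d \<longlonglongrightarrow> 0"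
    unfolding d_def using tendsto_diff[OF LIMSEQ_Suc[OF y_lim] y_lim] by simp
  moreover have "\<forall>\<^sub>F n in sequentially. d n \<noteq> 0"
    using eventually_ge_at_top[of M] by eventually_elim (use d_neg in fastforce)
  ultimately have "filterlim d (at 0) sequentially"
    by (simp add: filterlim_at)
  moreover have "((\<lambda>t. f t / t) \<longlongrightarrow> a) (at 0)"
    using deriv \<open>f 0 = 0\<close> by (simp add: has_field_derivative_iff)
  ultimately have "q \<longlonglongrightarrow> a"
    unfolding q_def by (rule filterlim_compose[rotated])
  hence "(\<lambda>n. 2 * sqrt (q n) - c - q n) \<longlonglongrightarrow> 2 * sqrt a - c - a"
    by (intro tendsto_intros)
  \<comment> \<open>Half of the limiting gap is a descent that is uniform from some index on.\<close>
  moreover define e where "e = (2 * sqrt a - c - a) / 2"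
  moreover have "e > 0" and "e < 2 * sqrt a - c - a"
    using disc by (auto simp: e_def)
  ultimately have "\<forall>\<^sub>F n in sequentially. e < 2 * sqrt (q n) - c - q n"
    by (intro order_tendstoD(1))
  then obtain K where K: "\<And>n. n \<ge> K \<Longrightarrow> e < 2 * sqrt (q n) - c - q n"
    by (auto simp: eventually_sequentially)
  have r_pos: "r n > 0" for n
    using pos by (simp add: r_def)
  have "r (Suc n) \<le> r n - e" if "n \<ge> max M K" for n
  proof -
    have "d n < 0" using d_neg that by simp
    hence "f (d n) = q n * d n" by (simp add: q_def)
    hence "r (Suc n) = c + q n * (1 - 1 / r n)"
      using pos[of n] pos[of "Suc n"] unfolding r_def rec
      by (simp add: d_def field_simps)
    also have "\<dots> \<le> r n - (2 * sqrt (q n) - c - q n)"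
      using slope[of "d n"] \<open>d n < 0\<close> r_pos by (intro ratio_map_descent) (auto simp: q_def)
    also have "\<dots> \<le> r n - e" using K[of n] that by simp
    finally show ?thesis .
  qed
  with constant_descent_becomes_negative[OF \<open>e > 0\<close>, of "max M K" r] r_pos show False
    by (metis less_asym)
qed

lemma not_eventually_positive_solution:
  fixes f :: "real \<Rightarrow> real" and x :: "nat \<Rightarrow> real"
  assumes "c < 1" "a < 1"
    and "\<And>t. t \<noteq> 0 \<Longrightarrow> 0 < f t / t \<and> f t / t \<le> a"
    and "(f has_real_derivative a) (at 0)"
    and "c + a < 2 * sqrt a"
    and sol: "solves_difference_eq c f x"
  shows "\<not> eventually_positive x"
proof
  assume "eventually_positive x"
  then obtain N where N: "\<And>n. n \<ge> N \<Longrightarrow> x n > 0"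
    by (auto simp: eventually_positive_def eventually_sequentially)
  have "x (Suc (Suc n) + N) = c * x (Suc n + N) + f (x (Suc n + N) - x (n + N))" for n
    using sol[unfolded solves_difference_eq_def, rule_format, of "Suc (n + N)"] by simp
  thus False
    using no_positive_solution[OF assms(1-5), of "\<lambda>n. x (n + N)"] N by simp
qed

lemma solves_difference_eq_uminus:
  assumes "solves_difference_eq c f x"
  shows "solves_difference_eq c (\<lambda>t. - f (- t)) (\<lambda>n. - x n)"
  using assms by (simp add: solves_difference_eq_def)

section \<open>A positive solution when the characteristic roots are real\<close>

fun solution_from_1_1 :: "real \<Rightarrow> (real \<Rightarrow> real) \<Rightarrow> nat \<Rightarrow> real" where
  "solution_from_1_1 c f 0 = 1"
| "solution_from_1_1 c f (Suc 0) = 1"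
| "solution_from_1_1 c f (Suc (Suc n)) =
     c * solution_from_1_1 c f (Suc n)
       + f (solution_from_1_1 c f (Suc n) - solution_from_1_1 c f n)"

lemma solution_from_1_1_solves: "solves_difference_eq c f (solution_from_1_1 c f)"
  unfolding solves_difference_eq_def
proof (intro allI impI)
  fix n :: nat
  assume "1 \<le> n"
  then obtain m where "n = Suc m" by (cases n) auto
  thus "solution_from_1_1 c f (n + 1) = c * solution_from_1_1 c f n
      + f (solution_from_1_1 c f n - solution_from_1_1 c f (n - 1))" by simp
qed

text \<open>
  The upper bound in the invariant keeps the increments nonpositive, where $f$ lies above the line
  of slope $s^2$. There the ratio of consecutive terms is at least $c + s^2 - s^2/r$ for
  the previous ratio $r \ge s$. This is increasing in $r$, and at $r = s$ its value
  $c + s^2 - s$ is at least $s$ by hypothesis.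
\<close>

lemma solution_bounded_below_by_ratio:
  fixes f :: "real \<Rightarrow> real"
  assumes "c \<le> 1" "0 < s" "s \<le> 1" and disc: "2 * s \<le> c + s\<^sup>2"
    and nonpos: "\<And>t. t \<le> 0 \<Longrightarrow> f t \<le> 0 \<and> s\<^sup>2 * t \<le> f t"
  defines "x \<equiv> solution_from_1_1 c f"
  shows "0 < x n \<and> s * x n \<le> x (Suc n) \<and> x (Suc n) \<le> x n"
proof (induction n)
  case 0
  show ?case using assms by simp
next
  case (Suc n)
  have pos: "0 < x (Suc n)"
    using Suc \<open>0 < s\<close> by (meson less_le_trans mult_pos_pos)
  have inc: "x (Suc n) - x n \<le> 0" using Suc by simp
  have rec: "x (Suc (Suc n)) = c * x (Suc n) + f (x (Suc n) - x n)"
    by (simp add: x_def)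
  have "s * x (Suc n) \<le> 2 * s * x (Suc n) - s * (s * x n)"
    using Suc \<open>0 < s\<close> by simp
  also have "\<dots> \<le> (c + s\<^sup>2) * x (Suc n) - s * (s * x n)"
    using disc pos by (simp add: mult_right_mono)
  also have "\<dots> = c * x (Suc n) + s\<^sup>2 * (x (Suc n) - x n)"
    by (simp add: algebra_simps power2_eq_square)
  also have "\<dots> \<le> x (Suc (Suc n))"
    unfolding rec using nonpos[OF inc] by simp
  finally have lower: "s * x (Suc n) \<le> x (Suc (Suc n))" .
  have "c * x (Suc n) \<le> x (Suc n)"
    using pos \<open>c \<le> 1\<close> by simp
  hence "x (Suc (Suc n)) \<le> x (Suc n)"
    unfolding rec using nonpos[OF inc] by simp
  with pos lower show ?case by simp
qed

section \<open>The oscillation criterion\<close>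

theorem corollary3p5:
  fixes c :: real and f :: "real \<Rightarrow> real"
  assumes "c \<in> {0..<1}"
    and "continuous_on UNIV f"
    and "continuously_differentiable_at f 0"
    and "\<And>t. t \<noteq> 0 \<Longrightarrow> 0 < f t / t \<and> f t / t \<le> deriv f 0"
    and "deriv f 0 < 1"
  shows "oscillatory_difference_eq c f \<longleftrightarrow> deriv f 0 > (1 - sqrt (1 - c))\<^sup>2"
proof -
  define a where "a = deriv f 0"
  have c: "0 \<le> c" "c < 1" using assms(1) by auto
  have slope: "0 < f t / t \<and> f t / t \<le> a" if "t \<noteq> 0" for t
    using assms(4)[OF that] by (simp add: a_def)
  have a: "0 < a" "a < 1"
    using slope[of 1] assms(5) by (auto simp: a_def)
  have "f differentiable (at 0)"
    using assms(3) eventually_nhds_x_imp_x unfolding continuously_differentiable_at_def by blast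
  hence deriv: "(f has_real_derivative a) (at 0)"
    by (simp add: a_def DERIV_deriv_iff_real_differentiable)
  have "f 0 = 0"
    using slope_bounds_imp_zero_at_0[OF slope] deriv DERIV_isCont by blast
  have "oscillatory_difference_eq c f \<longleftrightarrow> c + a < 2 * sqrt a"
  proof
    assume disc: "c + a < 2 * sqrt a"
    define g where "g t = - f (- t)" for t
    have g_slope: "0 < g t / t \<and> g t / t \<le> a" if "t \<noteq> 0" for t
      using slope[of "- t"] that by (simp add: g_def)
    have g_deriv: "(g has_real_derivative a) (at 0)"
      unfolding g_def using deriv by (auto intro!: derivative_eq_intros DERIV_chain2[of f])
    show "oscillatory_difference_eq c f"
      unfolding oscillatory_difference_eq_def
    proof (intro allI impI conjI)
      fix x assume sol: "solves_difference_eq c f x"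
      show "\<not> eventually_positive x"
        using not_eventually_positive_solution[OF c(2) a(2) slope deriv disc sol] .
      have "solves_difference_eq c g (\<lambda>n. - x n)"
        unfolding g_def using solves_difference_eq_uminus[OF sol] .
      from not_eventually_positive_solution[OF c(2) a(2) g_slope g_deriv disc this]
      show "\<not> eventually_negative x"
        by (simp add: eventually_positive_def eventually_negative_def)
    qed
  next
    assume osc: "oscillatory_difference_eq c f"
    show "c + a < 2 * sqrt a"
    proof (rule ccontr)
      assume "\<not> ?thesis"
      hence disc: "2 * sqrt a \<le> c + (sqrt a)\<^sup>2"
        using a by simp
      have nonpos: "f t \<le> 0 \<and> (sqrt a)\<^sup>2 * t \<le> f t" if "t \<le> 0" for t
        using that slope_bounds(2)[of f, OF slope, of t] \<open>f 0 = 0\<close> a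
        by (cases "t = 0") auto
      have "solution_from_1_1 c f n > 0" for n
        using solution_bounded_below_by_ratio[OF _ _ _ disc nonpos] c a by simp
      hence "eventually_positive (solution_from_1_1 c f)"
        by (simp add: eventually_positive_def)
      with osc solution_from_1_1_solves show False
        by (auto simp: oscillatory_difference_eq_def)
    qed
  qed
  thus ?thesis
    using threshold_iff_negative_discriminant[OF c a] by (simp add: a_def)
qed

end
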